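(* Let $\Omega\subset C\subset\mathbb{R}$ be intervals with $\Omega$ open, let $\mu_0\in\Omega$ and $\mu\in\mathbb{R}$, and let $Y\sim DM(\mu_0+\sigma\mu,\sigma^2)$ be a dispersion model with uniformly convergent saddlepoint approximation (in particular, its unit deviance $d$ is regular). Put $Z=(Y-\mu_0)/\sigma$. Assume that the unit deviance $d=d(y;\mu)$ is of class $C^3$, that is, three times continuously differentiable, with $\partial^3_{yyy}d(\mu_0;\mu_0)\neq 0$. If $x_\sigma\in(0,\infty)$, for $\sigma\in(0,\infty)$, is such that $\lim_{\sigma^2\to 0}(x_\sigma-\mu)^3\sigma=\beta\in[0,\infty]$, then the pdf $f(x;\mu,\sigma^2)$ of $Z$ satisfies $$\lim_{\sigma^2\to 0}\frac{f(x_\sigma;\mu,\sigma^2)}{\phi(x_\sigma;\mu,V(\mu_0))}=\exp\left\{-\frac{\beta}{12}\,\partial^3_{yyy}d(\mu_0;\mu_0)\right\}.$$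
   Context: Unit deviance: for intervals $\Omega\subset C\subset\mathbb{R}$ with $\Omega$ open, a function $d:C\times\Omega\to\mathbb{R}$, written $d(y;\mu)$, is a unit deviance if $d(y;y)=0$ for all $y\in\Omega$ and $d(y;\mu)>0$ for all $y\neq\mu$. It is regular if it is twice continuously differentiable in $(y,\mu)$ on $\Omega\times\Omega$ and $\partial^2_{\mu\mu}d(\mu;\mu)>0$ for all $\mu\in\Omega$. Subscripts on $\partial$ denote the variables of partial differentiation (first argument $y$, second argument $\mu$); e.g. $\partial^3_{yyy}d(\mu_0;\mu_0)$ is the third partial derivative in the first argument evaluated at $(y,\mu)=(\mu_0,\mu_0)$. Differentiability assumptions on $d$ are on $\Omega\times\Omega$. Unit variance function: $V:\Omega\to\mathbb{R}_+$, $V(\mu)=2/\partial^2_{\mu\mu}d(\mu;\mu)$. Dispersion model: $DM(\mu,\sigma^2)$, with position parameter $\mu\in\Omega$ and dispersion parameter $\sigma^2>0$, is the distribution on $C$ whose pdf with respect to some $\sigma$-finite measure (usually Lebesgue or counting measure) is $$f_Y(y;\mu,\sigma^2)=a(y;\sigma^2)\exp\left\{-\frac{1}{2\sigma^2}d(y;\mu)\right\},\quad y\in C,$$ where $a\ge 0$ is a suitable function and $d$ is a unit deviance on $C\times\Omega$. The functions $a$ and $d$ are fixed, and $DM(\mu_0+\sigma\mu,\sigma^2)$ is considered for $\sigma>0$ small enough that $\mu_0+\sigma\mu\in\Omega$. Saddlepoint approximation: for regular $d$, it states that $f_Y(y;\mu,\sigma^2)\sim\{2\pi\sigma^2V(y)\}^{-1/2}\exp\{-d(y;\mu)/(2\sigma^2)\}$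 as $\sigma^2\to0$ for $y\in\Omega$ (ratio tending to $1$), equivalently $\sigma a(y;\sigma^2)\to\{2\pi V(y)\}^{-1/2}$ as $\sigma^2\to 0$. It is uniformly convergent if this convergence is uniform for $y$ in compact subsets of $\Omega$. The pdf of $Z=(Y-\mu_0)/\sigma$ is $f(x;\mu,\sigma^2)=\sigma f_Y(\mu_0+\sigma x;\mu_0+\sigma\mu,\sigma^2)$. $\phi(x;\mu,v)$ denotes the pdf of the normal distribution with mean $\mu$ and variance $v$. Throughout $\sigma=\sqrt{\sigma^2}>0$. When $\beta=\infty$, the right-hand side is read with $\exp(-\infty)=0$ and $\exp(+\infty)=\infty$.
   Formalization: For β = ∞ the formal theorem additionally assumes σ·x_σ → 0 as σ² → 0; without this the claim fails, e.g. d(y;μ) = h(y−μ) with h(t) = t²(1+sin(4t)/2), μ₀ = μ = 0, x_σ = 1/σ. *)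

theory Defs
  imports "HOL-Probability.Probability"
begin

text \<open>
  \<open>C_k_on k f S\<close> is meant for open \<open>S\<close>: \<open>f\<close> is \<open>k\<close> times continuously differentiable on \<open>S\<close>,
  expressed through iterated directional derivatives. A function of two real variables is viewed
  as a function on \<open>real \<times> real\<close>.
\<close>

fun C_k_on :: "nat \<Rightarrow> ('a::real_normed_vector \<Rightarrow> 'b::real_normed_vector) \<Rightarrow> 'a set \<Rightarrow> bool" where
  "C_k_on 0 f S \<longleftrightarrow> continuous_on S f"
| "C_k_on (Suc k) f S \<longleftrightarrow>
     f differentiable_on S \<and> (\<forall>v. C_k_on k (\<lambda>x. frechet_derivative f (at x) v) S)"

definition partial_y :: "nat \<Rightarrow> (real \<Rightarrow> real \<Rightarrow> real) \<Rightarrow> real \<Rightarrow> real \<Rightarrow> real" where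
  "partial_y k d y m = (deriv ^^ k) (\<lambda>t. d t m) y"

definition partial_mu :: "nat \<Rightarrow> (real \<Rightarrow> real \<Rightarrow> real) \<Rightarrow> real \<Rightarrow> real \<Rightarrow> real" where
  "partial_mu k d y m = (deriv ^^ k) (\<lambda>t. d y t) m"

definition unit_deviance :: "real set \<Rightarrow> real set \<Rightarrow> (real \<Rightarrow> real \<Rightarrow> real) \<Rightarrow> bool" where
  "unit_deviance C \<Omega> d \<longleftrightarrow>
     (\<forall>y\<in>\<Omega>. d y y = 0) \<and> (\<forall>y\<in>C. \<forall>m\<in>\<Omega>. y \<noteq> m \<longrightarrow> d y m > 0)"

definition regular_unit_deviance :: "real set \<Rightarrow> real set \<Rightarrow> (real \<Rightarrow> real \<Rightarrow> real) \<Rightarrow> bool" where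
  "regular_unit_deviance C \<Omega> d \<longleftrightarrow>
     unit_deviance C \<Omega> d \<and> C_k_on 2 (\<lambda>(y, m). d y m) (\<Omega> \<times> \<Omega>) \<and>
     (\<forall>m\<in>\<Omega>. partial_mu 2 d m m > 0)"

definition unit_variance :: "(real \<Rightarrow> real \<Rightarrow> real) \<Rightarrow> real \<Rightarrow> real" where
  "unit_variance d m = 2 / partial_mu 2 d m m"

text \<open>
  In the following definitions the parameter \<open>s\<close> is the dispersion parameter, that is,
  \<open>s\<close> stands for \<open>\<sigma>\<^sup>2\<close> and not for \<open>\<sigma>\<close>.
\<close>

definition DM_pdf ::
  "(real \<Rightarrow> real \<Rightarrow> real) \<Rightarrow> (real \<Rightarrow> real \<Rightarrow> real) \<Rightarrow> real \<Rightarrow> real \<Rightarrow> real \<Rightarrow> real" where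
  "DM_pdf a d m s y = a y s * exp (- (1 / (2 * s)) * d y m)"

text \<open>
  \<open>has_DM C \<Omega> a d m s M Y\<close>: the random variable \<open>Y\<close> on the probability space \<open>M\<close> has the
  distribution \<open>DM(m, s)\<close>. The dominating measure \<open>\<nu>\<close> lives on \<open>C\<close> with its Borel sets, and it
  may be any \<open>\<sigma>\<close>-finite measure.
\<close>

definition has_DM ::
  "real set \<Rightarrow> real set \<Rightarrow> (real \<Rightarrow> real \<Rightarrow> real) \<Rightarrow> (real \<Rightarrow> real \<Rightarrow> real) \<Rightarrow> real \<Rightarrow> real \<Rightarrow>
    'w measure \<Rightarrow> ('w \<Rightarrow> real) \<Rightarrow> bool" where
  "has_DM C \<Omega> a d m s M Y \<longleftrightarrow>
     unit_deviance C \<Omega> d \<and> m \<in> \<Omega> \<and> s > 0 \<and> (\<forall>y\<in>C. a y s \<ge> 0) \<and> prob_space M \<and>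
     (\<exists>\<nu>. sigma_finite_measure \<nu> \<and> sets \<nu> = sets (restrict_space borel C) \<and>
          distributed M \<nu> Y (\<lambda>y. ennreal (DM_pdf a d m s y)))"

definition uniform_saddlepoint ::
  "real set \<Rightarrow> real set \<Rightarrow> (real \<Rightarrow> real \<Rightarrow> real) \<Rightarrow> (real \<Rightarrow> real \<Rightarrow> real) \<Rightarrow> bool" where
  "uniform_saddlepoint C \<Omega> a d \<longleftrightarrow>
     regular_unit_deviance C \<Omega> d \<and>
     (\<forall>K. compact K \<and> K \<subseteq> \<Omega> \<longrightarrow>
        uniform_limit K (\<lambda>\<sigma> y. \<sigma> * a y (\<sigma>\<^sup>2)) (\<lambda>y. (2 * pi * unit_variance d y) powr (- 1 / 2))
          (at_right 0))"

text \<open>The pdf of \<open>Z = (Y - \<mu>\<^sub>0) / \<sigma>\<close> for \<open>Y \<sim> DM(\<mu>\<^sub>0 + \<sigma> \<mu>, \<sigma>\<^sup>2)\<close>; here the parameter is \<open>\<sigma>\<close> itself.\<close>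

definition DM_std_pdf ::
  "(real \<Rightarrow> real \<Rightarrow> real) \<Rightarrow> (real \<Rightarrow> real \<Rightarrow> real) \<Rightarrow> real \<Rightarrow> real \<Rightarrow> real \<Rightarrow> real \<Rightarrow> real" where
  "DM_std_pdf a d \<mu>0 \<mu> \<sigma> x = \<sigma> * DM_pdf a d (\<mu>0 + \<sigma> * \<mu>) (\<sigma>\<^sup>2) (\<mu>0 + \<sigma> * x)"

text \<open>
  The factor \<open>\<sigma>\<close> above corresponds to the dominating measure \<open>1 / \<sigma>\<close> times the image of \<open>\<nu>\<close> under
  \<open>y \<mapsto> (y - \<mu>\<^sub>0) / \<sigma>\<close>. If \<open>\<nu>\<close> is Lebesgue measure on \<open>C\<close>, this is again Lebesgue measure.
\<close>

lemma distributed_DM_std_pdf: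
  fixes \<nu> :: "real measure" and \<mu>0 \<sigma> :: real
  defines "T \<equiv> \<lambda>y::real. (y - \<mu>0) / \<sigma>"
  assumes \<sigma>: "\<sigma> > 0" and sets: "sets \<nu> = sets (restrict_space borel C)"
    and Y: "distributed M \<nu> Y (\<lambda>y. ennreal (DM_pdf a d (\<mu>0 + \<sigma> * \<mu>) (\<sigma>\<^sup>2) y))"
  shows "distributed M
           (scale_measure (ennreal (1 / \<sigma>)) (distr \<nu> (restrict_space borel (T ` C)) (T)))
           (\<lambda>\<omega>. (Y \<omega> - \<mu>0) / \<sigma>) (\<lambda>x. ennreal (DM_std_pdf a d \<mu>0 \<mu> \<sigma> x))"
proof -
  let ?R = "restrict_space borel (T ` C) :: real measure"
  let ?g = "\<lambda>y. ennreal (DM_pdf a d (\<mu>0 + \<sigma> * \<mu>) (\<sigma>\<^sup>2) y)"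
  let ?f = "\<lambda>x. ennreal (DM_std_pdf a d \<mu>0 \<mu> \<sigma> x)"
  let ?N = "scale_measure (ennreal (1 / \<sigma>)) (distr \<nu> ?R T)"
  have sp: "space \<nu> = C"
    using sets_eq_imp_space_eq[OF sets] by (simp add: space_restrict_space)
  have T: "T \<in> measurable \<nu> ?R"
    unfolding measurable_cong_sets[OF sets refl] T_def
    by (rule measurable_restrict_space2) (auto simp: space_restrict_space intro!: measurable_restrict_space1)
  have S: "(\<lambda>x. \<mu>0 + \<sigma> * x) \<in> measurable ?R \<nu>"
    unfolding measurable_cong_sets[OF refl sets] T_def using \<sigma>
    by (intro measurable_restrict_space2) (auto simp: space_restrict_space intro!: measurable_restrict_space1)
  have g: "?g \<in> borel_measurable \<nu>" and Ym: "Y \<in> measurable M \<nu>"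
    and eq: "distr M \<nu> Y = density \<nu> ?g"
    using Y by (auto simp: distributed_def)
  have f_eq: "?f = (\<lambda>x. ennreal \<sigma> * ?g (\<mu>0 + \<sigma> * x))"
    using \<sigma> by (auto simp: DM_std_pdf_def ennreal_mult')
  have h: "(\<lambda>x. ?g (\<mu>0 + \<sigma> * x)) \<in> borel_measurable ?R"
    by (rule measurable_compose[OF S g])
  then have f: "?f \<in> borel_measurable ?R"
    unfolding f_eq by measurable
  have ST: "\<mu>0 + \<sigma> * T y = y" for y
    using \<sigma> by (simp add: T_def)
  have "density ?N ?f = density (distr \<nu> ?R T) (\<lambda>x. ?g (\<mu>0 + \<sigma> * x))"
  proof (rule measure_eqI)
    fix A assume "A \<in> sets (density ?N ?f)"
    then have A: "A \<in> sets ?R" by simp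
    have "emeasure (density ?N ?f) A
        = ennreal (1 / \<sigma>) * (\<integral>\<^sup>+x. ennreal \<sigma> * (?g (\<mu>0 + \<sigma> * x) * indicator A x) \<partial>distr \<nu> ?R T)"
    proof -
      have "(\<lambda>x. ennreal \<sigma> * (?g (\<mu>0 + \<sigma> * x) * indicator A x)) \<in> borel_measurable (distr \<nu> ?R T)"
        using A h by auto
      from nn_integral_scale_measure[OF this] show ?thesis
        using A f by (simp add: emeasure_density f_eq mult.assoc)
    qed
    also have "\<dots> = ennreal (1 / \<sigma>) * (ennreal \<sigma> *
        (\<integral>\<^sup>+x. ?g (\<mu>0 + \<sigma> * x) * indicator A x \<partial>distr \<nu> ?R T))"
      using A h by (subst nn_integral_cmult) auto
    also have "\<dots> = (\<integral>\<^sup>+x. ?g (\<mu>0 + \<sigma> * x) * indicator A x \<partial>distr \<nu> ?R T)"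
      using \<sigma> by (simp add: mult.assoc[symmetric] ennreal_mult'[symmetric])
    finally show "emeasure (density ?N ?f) A
        = emeasure (density (distr \<nu> ?R T) (\<lambda>x. ?g (\<mu>0 + \<sigma> * x))) A"
      using A h by (simp add: emeasure_density)
  qed simp
  also have "\<dots> = distr (density \<nu> (\<lambda>y. ?g (\<mu>0 + \<sigma> * T y))) ?R T"
    by (rule density_distr[OF h T])
  also have "\<dots> = distr (distr M \<nu> Y) ?R T"
    by (simp only: ST eq)
  also have "\<dots> = distr M ?R (\<lambda>\<omega>. T (Y \<omega>))"
    by (simp add: distr_distr[OF T Ym] comp_def)
  also have "\<dots> = distr M ?N (\<lambda>\<omega>. T (Y \<omega>))"
    by (rule distr_cong) auto
  finally have "distr M ?N (\<lambda>\<omega>. T (Y \<omega>)) = density ?N ?f" by simp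
  moreover have "(\<lambda>\<omega>. T (Y \<omega>)) \<in> measurable M ?N"
    using measurable_compose[OF Ym T] by (simp cong: measurable_cong_sets)
  moreover have "?f \<in> borel_measurable ?N"
    using f by (simp cong: measurable_cong_sets)
  ultimately show ?thesis
    by (simp add: distributed_def T_def)
qed

definition exp_ereal :: "ereal \<Rightarrow> ereal" where
  "exp_ereal z = (case z of ereal r \<Rightarrow> ereal (exp r) | PInfty \<Rightarrow> \<infinity> | MInfty \<Rightarrow> 0)"

end

theory Submission
  imports Defs
begin

text \<open>
  The position \<open>m = \<mu>0 + \<sigma> * \<mu>\<close> and the argument \<open>y = \<mu>0 + \<sigma> * x\<close> both tend to \<open>\<mu>0\<close>, the latter by
  assumption if \<open>\<beta> = \<infinity>\<close> and by \<open>step_tendsto_0\<close> otherwise. Their difference \<open>y - m\<close> is \<open>\<sigma> * X\<close> with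
  \<open>X = x - \<mu>\<close>. Since \<open>d\<close> vanishes to first order on the diagonal, a third-order Taylor
  expansion in the first argument at \<open>m\<close> (\<open>unit_deviance_cubic_expansion\<close>) gives
  \<open>d y m / (2 * \<sigma>\<^sup>2) = q m * X\<^sup>2 / 4 + d\<^sub>y\<^sub>y\<^sub>y \<xi> m * (X ^ 3 * \<sigma>) / 12\<close>,
  where \<open>q t = d\<^sub>y\<^sub>y t t\<close> and \<open>\<xi>\<close> lies between \<open>m\<close> and \<open>y\<close>. On the diagonal the second partial derivatives
  in both arguments agree (\<open>second_partials_agree_on_diagonal\<close>), so \<open>q = 2 / V\<close> and the exponent of the
  normal density is \<open>- q \<mu>0 * X\<^sup>2 / 4\<close>. Dividing the two exponentials therefore leaves minus the sum of the
  cubic term and of \<open>((q m - q \<mu>0) / \<sigma>) * (X\<^sup>2 * \<sigma>) / 4\<close>.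

  The difference quotient is bounded because \<open>q\<close> is differentiable at \<open>\<mu>0\<close>. If \<open>X ^ 3 * \<sigma>\<close> has a finite
  limit, then \<open>X\<^sup>2 * \<sigma>\<close> tends to \<open>0\<close>; if \<open>X ^ 3 * \<sigma>\<close> tends to infinity, then \<open>X\<close> tends to infinity and
  \<open>X\<^sup>2 * \<sigma>\<close> is negligible against \<open>X ^ 3 * \<sigma>\<close>, whose coefficient has the nonzero limit
  \<open>d\<^sub>y\<^sub>y\<^sub>y \<mu>0 \<mu>0 / 12\<close>. In both cases the exponent tends, in the extended reals, to
  \<open>- (\<beta> / 12) * d\<^sub>y\<^sub>y\<^sub>y \<mu>0 \<mu>0\<close> (\<open>cubic_exponent_tendsto\<close>). The uniform saddlepoint approximation makes the
  quotient of the remaining factors tend to \<open>1\<close>, although it is taken at the moving point \<open>y\<close>.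
\<close>

section \<open>Taylor expansion in one variable of a function of two variables\<close>

text \<open>
  Iterating this operator in a fixed direction turns a smooth function on \<open>real \<times> real\<close> into one of its
  pure partial derivatives, again as a function of the pair. The notion \<open>C_k_on\<close> is closed under it,
  whereas a partial derivative defined with the second variable held fixed says nothing about joint
  continuity.
\<close>

definition dirderiv :: "'a::real_normed_vector \<Rightarrow> ('a \<Rightarrow> real) \<Rightarrow> 'a \<Rightarrow> real" where
  "dirderiv v f = (\<lambda>x. frechet_derivative f (at x) v)"

lemma C_k_on_dirderiv_funpow:
  "C_k_on (j + k) f S \<Longrightarrow> C_k_on k ((dirderiv v ^^ j) f) S"
  by (induction j arbitrary: f) (auto simp: dirderiv_def funpow_Suc_right simp del: funpow.simps(2))

lemma C_k_on_imp_continuous_on: "C_k_on k f S \<Longrightarrow> continuous_on S f"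
  by (cases k) (auto intro: differentiable_imp_continuous_on)

lemma dirderiv_funpow_differentiable:
  assumes "C_k_on n f S" "j < n" "open S" "p \<in> S"
  shows "((dirderiv v ^^ j) f) differentiable (at p)"
proof -
  have "C_k_on (Suc (n - Suc j)) ((dirderiv v ^^ j) f) S"
    using assms by (intro C_k_on_dirderiv_funpow) simp
  then show ?thesis
    using assms by (simp add: differentiable_on_eq_differentiable_at)
qed

lemma DERIV_along_line:
  assumes "C_k_on n f S" "j < n" "open S" "p + t *\<^sub>R v \<in> S"
  shows "((\<lambda>t. (dirderiv v ^^ j) f (p + t *\<^sub>R v))
           has_real_derivative (dirderiv v ^^ Suc j) f (p + t *\<^sub>R v)) (at t)"
proof -
  let ?g = "(dirderiv v ^^ j) f" and ?p = "p + t *\<^sub>R v"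
  have 1: "(?g has_derivative frechet_derivative ?g (at ?p)) (at ?p)"
    using dirderiv_funpow_differentiable[OF assms] by (simp add: frechet_derivative_works)
  have 2: "((\<lambda>t. p + t *\<^sub>R v) has_derivative (\<lambda>h. h *\<^sub>R v)) (at t)"
    by (auto intro!: derivative_eq_intros)
  have "((\<lambda>t. ?g (p + t *\<^sub>R v)) has_derivative (\<lambda>h. frechet_derivative ?g (at ?p) (h *\<^sub>R v))) (at t)"
    using diff_chain_at[OF 2 1] by (simp add: o_def)
  moreover have "frechet_derivative ?g (at ?p) (h *\<^sub>R v) = h * dirderiv v ?g ?p" for h
    using linear_frechet_derivative[OF dirderiv_funpow_differentiable[OF assms]]
    by (simp add: linear_cmul dirderiv_def)
  ultimately show ?thesis
    by (simp add: has_field_derivative_def mult.commute[of _ "dirderiv v _ _"])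
qed

text \<open>
  Each \<open>deriv\<close> depends on the values near \<open>t\<close>, so the induction needs the identity on a
  neighbourhood; openness of \<open>S\<close> supplies it.
\<close>

lemma deriv_funpow_along_line:
  assumes "C_k_on n f S" "j \<le> n" "open S" "p + t *\<^sub>R v \<in> S"
  shows "(deriv ^^ j) (\<lambda>t. f (p + t *\<^sub>R v)) t = (dirderiv v ^^ j) f (p + t *\<^sub>R v)"
  using assms(2,4)
proof (induction j arbitrary: t)
  case (Suc j)
  let ?U = "(\<lambda>t. p + t *\<^sub>R v) -` S"
  have "open ?U" by (intro open_vimage assms continuous_intros)
  moreover have "t \<in> ?U" using Suc.prems by simp
  ultimately have "\<forall>\<^sub>F s in nhds t. s \<in> ?U" by (rule eventually_nhds_in_open)
  then have "\<forall>\<^sub>F s in nhds t. (deriv ^^ j) (\<lambda>t. f (p + t *\<^sub>R v)) s = (dirderiv v ^^ j) f (p + s *\<^sub>R v)"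
    by eventually_elim (use Suc in auto)
  then have "deriv ((deriv ^^ j) (\<lambda>t. f (p + t *\<^sub>R v))) t
      = deriv (\<lambda>s. (dirderiv v ^^ j) f (p + s *\<^sub>R v)) t"
    by (intro deriv_cong_ev) auto
  also have "\<dots> = (dirderiv v ^^ Suc j) f (p + t *\<^sub>R v)"
    using DERIV_along_line[OF assms(1) _ assms(3), of j] Suc.prems by (intro DERIV_imp_deriv) auto
  finally show ?case by simp
qed simp

lemma Taylor_along_line:
  assumes "C_k_on n f S" "0 < n" "open S" and seg: "\<And>t. t \<in> closed_segment a b \<Longrightarrow> p + t *\<^sub>R v \<in> S"
  shows "\<exists>\<xi>\<in>closed_segment a b. f (p + b *\<^sub>R v) =
           (\<Sum>j<n. (dirderiv v ^^ j) f (p + a *\<^sub>R v) / fact j * (b - a) ^ j)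
             + (dirderiv v ^^ n) f (p + \<xi> *\<^sub>R v) / fact n * (b - a) ^ n"
proof (cases "a = b")
  case True
  then show ?thesis using \<open>0 < n\<close> by (cases n) (auto simp: sum.lessThan_Suc_shift simp del: sum.lessThan_Suc)
next
  case False
  have D: "\<forall>j t. j < n \<and> min a b \<le> t \<and> t \<le> max a b \<longrightarrow>
      DERIV (\<lambda>t. (dirderiv v ^^ j) f (p + t *\<^sub>R v)) t :> (dirderiv v ^^ Suc j) f (p + t *\<^sub>R v)"
    using seg by (intro allI impI DERIV_along_line[OF assms(1) _ assms(3)])
      (auto simp: closed_segment_eq_real_ivl min_def max_def split: if_splits)
  from Taylor[where diff = "\<lambda>j t. (dirderiv v ^^ j) f (p + t *\<^sub>R v)" and f = "\<lambda>t. f (p + t *\<^sub>R v)",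
      OF \<open>0 < n\<close> _ D, of a b] False
  obtain \<xi> where "if b < a then b < \<xi> \<and> \<xi> < a else a < \<xi> \<and> \<xi> < b"
    "f (p + b *\<^sub>R v) =
           (\<Sum>j<n. (dirderiv v ^^ j) f (p + a *\<^sub>R v) / fact j * (b - a) ^ j)
             + (dirderiv v ^^ n) f (p + \<xi> *\<^sub>R v) / fact n * (b - a) ^ n"
    by auto
  then show ?thesis
    by (intro bexI[of _ \<xi>]) (auto simp: closed_segment_eq_real_ivl split: if_splits)
qed

lemma partial_y_eq_dirderiv:
  assumes "C_k_on n (\<lambda>(y, m). d y m) S" "j \<le> n" "open S" "(y, m) \<in> S"
  shows "partial_y j d y m = (dirderiv (1, 0) ^^ j) (\<lambda>(y, m). d y m) (y, m)"
  using deriv_funpow_along_line[OF assms(1-3), of "(0, m)" y "(1, 0)"] assms(4)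
  by (simp add: partial_y_def)

lemma partial_mu_eq_dirderiv:
  assumes "C_k_on n (\<lambda>(y, m). d y m) S" "j \<le> n" "open S" "(y, m) \<in> S"
  shows "partial_mu j d y m = (dirderiv (0, 1) ^^ j) (\<lambda>(y, m). d y m) (y, m)"
  using deriv_funpow_along_line[OF assms(1-3), of "(y, 0)" m "(0, 1)"] assms(4)
  by (simp add: partial_mu_def)

text \<open>Joint continuity allows both arguments to move when the limits are taken below.\<close>

lemma continuous_on_partial:
  assumes "C_k_on n (\<lambda>(y, m). d y m) S" "j \<le> n" "open S"
  shows "continuous_on S (\<lambda>(y, m). partial_y j d y m)"
    and "continuous_on S (\<lambda>(y, m). partial_mu j d y m)"
proof -
  have c: "continuous_on S ((dirderiv v ^^ j) (\<lambda>(y, m). d y m))" for v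
    using assms C_k_on_dirderiv_funpow[of j "n - j"] by (intro C_k_on_imp_continuous_on) auto
  show "continuous_on S (\<lambda>(y, m). partial_y j d y m)"
    using c by (rule continuous_on_eq) (auto simp: partial_y_eq_dirderiv[OF assms])
  show "continuous_on S (\<lambda>(y, m). partial_mu j d y m)"
    using c by (rule continuous_on_eq) (auto simp: partial_mu_eq_dirderiv[OF assms])
qed

lemma Taylor_partial_y:
  assumes "C_k_on n (\<lambda>(y, m). d y m) (\<Omega> \<times> \<Omega>)" "0 < n" "open \<Omega>" "is_interval \<Omega>" "y \<in> \<Omega>" "y0 \<in> \<Omega>" "m \<in> \<Omega>"
  shows "\<exists>\<xi>\<in>closed_segment y0 y. d y m =
           (\<Sum>j<n. partial_y j d y0 m / fact j * (y - y0) ^ j) + partial_y n d \<xi> m / fact n * (y - y0) ^ n"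
proof -
  have seg: "closed_segment y0 y \<subseteq> \<Omega>"
    using assms by (simp add: closed_segment_subset is_interval_convex)
  have line: "(0, m) + t *\<^sub>R (1, 0) \<in> \<Omega> \<times> \<Omega>" if "t \<in> closed_segment y0 y" for t
    using that seg assms by auto
  obtain \<xi> where \<xi>: "\<xi> \<in> closed_segment y0 y"
    "(\<lambda>(y, m). d y m) ((0, m) + y *\<^sub>R (1, 0)) =
       (\<Sum>j<n. (dirderiv (1, 0) ^^ j) (\<lambda>(y, m). d y m) ((0, m) + y0 *\<^sub>R (1, 0)) / fact j * (y - y0) ^ j)
         + (dirderiv (1, 0) ^^ n) (\<lambda>(y, m). d y m) ((0, m) + \<xi> *\<^sub>R (1, 0)) / fact n * (y - y0) ^ n"
    using Taylor_along_line[OF assms(1,2) open_Times[OF assms(3,3)] line] by blast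
  have "(\<xi>, m) \<in> \<Omega> \<times> \<Omega>" "(y0, m) \<in> \<Omega> \<times> \<Omega>"
    using \<xi>(1) seg assms by auto
  then show ?thesis
    using \<xi> by (intro bexI[of _ \<xi>]) (auto simp: partial_y_eq_dirderiv[OF assms(1) _ open_Times[OF assms(3,3)]])
qed

lemma Taylor_partial_mu:
  assumes "C_k_on n (\<lambda>(y, m). d y m) (\<Omega> \<times> \<Omega>)" "0 < n" "open \<Omega>" "is_interval \<Omega>" "y \<in> \<Omega>" "m0 \<in> \<Omega>" "m \<in> \<Omega>"
  shows "\<exists>\<xi>\<in>closed_segment m0 m. d y m =
           (\<Sum>j<n. partial_mu j d y m0 / fact j * (m - m0) ^ j) + partial_mu n d y \<xi> / fact n * (m - m0) ^ n"
proof -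
  have seg: "closed_segment m0 m \<subseteq> \<Omega>"
    using assms by (simp add: closed_segment_subset is_interval_convex)
  have line: "(y, 0) + t *\<^sub>R (0, 1) \<in> \<Omega> \<times> \<Omega>" if "t \<in> closed_segment m0 m" for t
    using that seg assms by auto
  obtain \<xi> where \<xi>: "\<xi> \<in> closed_segment m0 m"
    "(\<lambda>(y, m). d y m) ((y, 0) + m *\<^sub>R (0, 1)) =
       (\<Sum>j<n. (dirderiv (0, 1) ^^ j) (\<lambda>(y, m). d y m) ((y, 0) + m0 *\<^sub>R (0, 1)) / fact j * (m - m0) ^ j)
         + (dirderiv (0, 1) ^^ n) (\<lambda>(y, m). d y m) ((y, 0) + \<xi> *\<^sub>R (0, 1)) / fact n * (m - m0) ^ n"
    using Taylor_along_line[OF assms(1,2) open_Times[OF assms(3,3)] line] by blast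
  have "(y, \<xi>) \<in> \<Omega> \<times> \<Omega>" "(y, m0) \<in> \<Omega> \<times> \<Omega>"
    using \<xi>(1) seg assms by auto
  then show ?thesis
    using \<xi> by (intro bexI[of _ \<xi>]) (auto simp: partial_mu_eq_dirderiv[OF assms(1) _ open_Times[OF assms(3,3)]])
qed

section \<open>Unit deviances near the diagonal\<close>

lemma unit_deviance_nonneg:
  assumes "unit_deviance C \<Omega> d" "\<Omega> \<subseteq> C" "y \<in> \<Omega>" "m \<in> \<Omega>"
  shows "0 \<le> d y m"
  using assms by (cases "y = m") (auto simp: unit_deviance_def less_imp_le)

lemma deriv_eq_0_at_min:
  fixes g :: "real \<Rightarrow> real"
  assumes "open U" "t \<in> U" "g differentiable (at t)" "\<And>s. s \<in> U \<Longrightarrow> g t \<le> g s"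
  shows "deriv g t = 0"
proof -
  obtain e where e: "e > 0" "ball t e \<subseteq> U" using assms openE by blast
  have "DERIV g t :> deriv g t" using assms(3) by (simp add: DERIV_deriv_iff_real_differentiable)
  then show ?thesis using e assms(4)
    by (elim DERIV_local_min[of _ _ _ e]) (auto simp: dist_real_def subset_iff)
qed

text \<open>A diagonal point is a minimum of \<open>d\<close> in each argument separately.\<close>

lemma first_partials_on_diagonal:
  assumes ud: "unit_deviance C \<Omega> d" and sub: "\<Omega> \<subseteq> C" and op: "open \<Omega>" and m: "m \<in> \<Omega>"
    and C: "C_k_on n (\<lambda>(y, m). d y m) (\<Omega> \<times> \<Omega>)" "0 < n"
  shows "partial_y 1 d m m = 0" and "partial_mu 1 d m m = 0"
proof -
  have mm: "d m m = 0" using ud m by (simp add: unit_deviance_def)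
  have "(\<lambda>t. d t m) differentiable (at m)"
    using DERIV_along_line[OF C, of "(0, m)" m "(1, 0)"] m op
    by (auto simp: open_Times real_differentiable_def)
  then have "deriv (\<lambda>t. d t m) m = 0"
    using unit_deviance_nonneg[OF ud sub] m op mm by (intro deriv_eq_0_at_min[of \<Omega>]) auto
  then show "partial_y 1 d m m = 0" by (simp add: partial_y_def)
  have "(\<lambda>t. d m t) differentiable (at m)"
    using DERIV_along_line[OF C, of "(m, 0)" m "(0, 1)"] m op
    by (auto simp: open_Times real_differentiable_def)
  then have "deriv (\<lambda>t. d m t) m = 0"
    using unit_deviance_nonneg[OF ud sub] m op mm by (intro deriv_eq_0_at_min[of \<Omega>]) auto
  then show "partial_mu 1 d m m = 0" by (simp add: partial_mu_def)
qed

lemma tendsto_in_closed_segment: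
  fixes f :: "'a \<Rightarrow> real"
  assumes "(f \<longlongrightarrow> l) F" "(g \<longlongrightarrow> l) F" "\<forall>\<^sub>F z in F. h z \<in> closed_segment (f z) (g z)"
  shows "(h \<longlongrightarrow> l) F"
proof (rule tendsto_sandwich)
  show "\<forall>\<^sub>F z in F. min (f z) (g z) \<le> h z" "\<forall>\<^sub>F z in F. h z \<le> max (f z) (g z)"
    using assms(3) by (auto elim!: eventually_mono simp: closed_segment_eq_real_ivl split: if_splits)
  show "((\<lambda>z. min (f z) (g z)) \<longlongrightarrow> l) F" "((\<lambda>z. max (f z) (g z)) \<longlongrightarrow> l) F"
    using tendsto_min[OF assms(1,2)] tendsto_max[OF assms(1,2)] by simp_all
qed

lemma tendsto_on_open_pair:
  fixes g :: "'a::t2_space \<Rightarrow> 'b::t2_space \<Rightarrow> 'c::topological_space"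
  assumes "continuous_on (A \<times> B) (\<lambda>(y, m). g y m)" "open A" "open B" "a \<in> A" "b \<in> B"
    and "(f \<longlongrightarrow> a) F" "(h \<longlongrightarrow> b) F"
  shows "((\<lambda>z. g (f z) (h z)) \<longlongrightarrow> g a b) F"
proof -
  have "isCont (\<lambda>(y, m). g y m) (a, b)"
    using assms by (simp add: continuous_on_eq_continuous_at open_Times)
  from isCont_tendsto_compose[OF this tendsto_Pair[OF assms(6,7)]] show ?thesis by simp
qed

text \<open>
  Expanding \<open>d y m\<close> to second order in \<open>y\<close> at \<open>m\<close>, and in \<open>m\<close> at \<open>y\<close>, writes it as half of \<open>(y - m)\<^sup>2\<close> times a
  second partial derivative in the one or the other argument, each at a point near \<open>(m, m)\<close>. Cancel
  the square and let \<open>y\<close> tend to \<open>m\<close>.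
\<close>

lemma second_partials_agree_on_diagonal:
  assumes ud: "unit_deviance C \<Omega> d" and sub: "\<Omega> \<subseteq> C" and op: "open \<Omega>" and iv: "is_interval \<Omega>"
    and C: "C_k_on 2 (\<lambda>(y, m). d y m) (\<Omega> \<times> \<Omega>)" and m: "m \<in> \<Omega>"
  shows "partial_y 2 d m m = partial_mu 2 d m m"
proof -
  have zero: "partial_y 0 d z z = 0" "partial_mu 0 d z z = 0" if "z \<in> \<Omega>" for z
    using ud that by (auto simp: partial_y_def partial_mu_def unit_deviance_def)
  note one = first_partials_on_diagonal[OF ud sub op _ C]
  have "\<exists>\<eta> \<xi>. \<eta> \<in> closed_segment m y \<and> \<xi> \<in> closed_segment y m \<and>
          partial_y 2 d \<eta> m = partial_mu 2 d y \<xi>" if y: "y \<in> \<Omega>" "y \<noteq> m" for y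
  proof -
    obtain \<eta> where \<eta>: "\<eta> \<in> closed_segment m y" "d y m = partial_y 2 d \<eta> m / 2 * (y - m)\<^sup>2"
      using Taylor_partial_y[OF C _ op iv y(1) m m] zero one m by (auto simp: numeral_2_eq_2)
    obtain \<xi> where \<xi>: "\<xi> \<in> closed_segment y m" "d y m = partial_mu 2 d y \<xi> / 2 * (m - y)\<^sup>2"
      using Taylor_partial_mu[OF C _ op iv y(1) y(1) m] zero one y by (auto simp: numeral_2_eq_2)
    have "(m - y)\<^sup>2 = (y - m)\<^sup>2" by (rule power2_commute)
    with \<eta> \<xi> y(2) show ?thesis by (intro exI[of _ \<eta>] exI[of _ \<xi>]) auto
  qed
  then obtain \<eta> \<xi> where *: "\<And>y. y \<in> \<Omega> \<Longrightarrow> y \<noteq> m \<Longrightarrow> \<eta> y \<in> closed_segment m y \<and>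
      \<xi> y \<in> closed_segment y m \<and> partial_y 2 d (\<eta> y) m = partial_mu 2 d y (\<xi> y)"
    by metis
  have opp: "open (\<Omega> \<times> \<Omega>)" using op op by (rule open_Times)
  have ev: "\<forall>\<^sub>F y in at m. y \<in> \<Omega> \<and> y \<noteq> m"
    using op m by (simp add: eventually_at_topological) blast
  have \<eta>: "(\<eta> \<longlongrightarrow> m) (at m)" and \<xi>: "(\<xi> \<longlongrightarrow> m) (at m)"
    by (rule tendsto_in_closed_segment[of "\<lambda>_. m" _ _ "\<lambda>y. y"] tendsto_in_closed_segment[of "\<lambda>y. y" _ _ "\<lambda>_. m"];
        use ev * in \<open>auto elim!: eventually_mono\<close>)+
  have "((\<lambda>y. partial_y 2 d (\<eta> y) m) \<longlongrightarrow> partial_y 2 d m m) (at m)"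
    by (rule tendsto_on_open_pair[OF continuous_on_partial(1)[OF C order_refl opp] op op m m \<eta> tendsto_const])
  moreover have "((\<lambda>y. partial_mu 2 d y (\<xi> y)) \<longlongrightarrow> partial_mu 2 d m m) (at m)"
    by (rule tendsto_on_open_pair[OF continuous_on_partial(2)[OF C order_refl opp] op op m m tendsto_ident_at \<xi>])
  then have "((\<lambda>y. partial_y 2 d (\<eta> y) m) \<longlongrightarrow> partial_mu 2 d m m) (at m)"
    by (rule Lim_transform_eventually) (use ev * in \<open>auto elim!: eventually_mono\<close>)
  ultimately show ?thesis
    by (rule tendsto_unique[rotated]) simp
qed

text \<open>
  The derivative along the diagonal moves both arguments, so total differentiability of the second
  partial derivative on the product is what counts here.
\<close>

lemma second_partial_differentiable_on_diagonal:
  assumes C: "C_k_on 3 (\<lambda>(y, m). d y m) (\<Omega> \<times> \<Omega>)" and op: "open \<Omega>" and m: "m \<in> \<Omega>"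
  shows "(\<lambda>t. partial_y 2 d t t) differentiable (at m)"
proof -
  let ?g = "(dirderiv (1, 0) ^^ 2) (\<lambda>(y, m). d y m)"
  have "?g differentiable (at (m, m))"
    using C op m by (intro dirderiv_funpow_differentiable[OF C]) (auto simp: open_Times)
  moreover have "(\<lambda>t. (t, t)) differentiable (at m)"
    unfolding differentiable_def by (rule exI, (rule derivative_intros)+)
  ultimately have "(\<lambda>t. ?g (t, t)) differentiable (at m)"
    using differentiable_chain_at[of "\<lambda>t. (t, t)" m ?g] by (simp add: o_def)
  then obtain D where "((\<lambda>t. ?g (t, t)) has_derivative D) (at m)" by (auto simp: differentiable_def)
  then have "((\<lambda>t. partial_y 2 d t t) has_derivative D) (at m)"
    by (rule has_derivative_transform_within_open[OF _ op m])
       (use op in \<open>simp add: partial_y_eq_dirderiv[OF C] open_Times\<close>)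
  then show ?thesis by (auto simp: differentiable_def)
qed

lemma unit_deviance_cubic_expansion:
  assumes ud: "unit_deviance C \<Omega> d" and sub: "\<Omega> \<subseteq> C" and op: "open \<Omega>" and iv: "is_interval \<Omega>"
    and C: "C_k_on 3 (\<lambda>(y, m). d y m) (\<Omega> \<times> \<Omega>)" and y: "y \<in> \<Omega>" and m: "m \<in> \<Omega>"
  shows "\<exists>\<xi>\<in>closed_segment m y.
           d y m = partial_y 2 d m m / 2 * (y - m)\<^sup>2 + partial_y 3 d \<xi> m / 6 * (y - m) ^ 3"
proof -
  have "partial_y 0 d m m = 0" 
    using ud m by (auto simp: partial_y_def unit_deviance_def)
  moreover have "partial_y 1 d m m = 0"
    using first_partials_on_diagonal[OF ud sub op m C] by simp
  moreover have "(fact 3 :: real) = 6" by (simp add: fact_numeral)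
  ultimately show ?thesis
    using Taylor_partial_y[OF C _ op iv y m m]
    by (simp add: numeral_3_eq_3 numeral_2_eq_2)
qed

section \<open>Limits\<close>

lemma exp_ereal_tendsto:
  assumes "((\<lambda>z. ereal (f z)) \<longlongrightarrow> l) F"
  shows "((\<lambda>z. ereal (exp (f z))) \<longlongrightarrow> exp_ereal l) F"
proof (cases l)
  case (real r)
  then show ?thesis using assms by (auto simp: exp_ereal_def intro!: tendsto_intros)
next
  case PInf
  then have "filterlim f at_top F" using assms by (simp add: tendsto_PInfty_eq_at_top)
  then have "filterlim (\<lambda>z. exp (f z)) at_top F" by (rule filterlim_compose[OF exp_at_top])
  then show ?thesis using PInf by (simp add: exp_ereal_def tendsto_PInfty_eq_at_top)
next
  case MInf
  then have "filterlim f at_bot F" using assms by (simp add: tendsto_MInfty filterlim_at_bot_dense)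
  then have "((\<lambda>z. exp (f z)) \<longlongrightarrow> 0) F" by (rule filterlim_compose[OF exp_at_bot])
  then show ?thesis using MInf by (simp add: exp_ereal_def zero_ereal_def)
qed

lemma uniform_limit_tendsto_compose:
  assumes u: "uniform_limit K g l F" and yK: "\<forall>\<^sub>F z in F. y z \<in> K"
    and l: "((\<lambda>z. l (y z)) \<longlongrightarrow> L) F"
  shows "((\<lambda>z. g z (y z)) \<longlongrightarrow> (L :: 'b :: metric_space)) F"
proof (rule tendstoI)
  fix e :: real assume "e > 0"
  then have "\<forall>\<^sub>F z in F. \<forall>y\<in>K. dist (g z y) (l y) < e / 2" "\<forall>\<^sub>F z in F. dist (l (y z)) L < e / 2"
    using uniform_limitD[OF u, of "e / 2"] tendstoD[OF l, of "e / 2"] by auto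
  with yK show "\<forall>\<^sub>F z in F. dist (g z (y z)) L < e"
    by eventually_elim (metis dist_triangle_half_r dist_commute)
qed

lemma tendsto_0_of_cube:
  fixes f :: "'a \<Rightarrow> real"
  assumes "((\<lambda>z. f z ^ 3) \<longlongrightarrow> 0) F"
  shows "(f \<longlongrightarrow> 0) F"
  using tendsto_real_root[OF assms, of 3] by (simp add: odd_real_root_power_cancel)

text \<open>
  Cubes avoid fractional powers: \<open>(X\<^sup>2 * \<sigma>) ^ 3\<close> equals \<open>(X ^ 3 * \<sigma>)\<^sup>2 * \<sigma>\<close>, which tends to \<open>0\<close> when \<open>\<beta>\<close> is
  finite, and \<open>(1 / X) ^ 3\<close> equals \<open>\<sigma> / (X ^ 3 * \<sigma>)\<close>, which tends to \<open>0\<close> when \<open>\<beta>\<close> is infinite. In the second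
  case \<open>X ^ 3 * \<sigma>\<close> is factored out of the exponent, and \<open>D \<noteq> 0\<close> decides the sign of the infinite limit.
\<close>

lemma cubic_exponent_tendsto:
  fixes X R T :: "real \<Rightarrow> real"
  assumes w: "((\<lambda>\<sigma>. ereal (X \<sigma> ^ 3 * \<sigma>)) \<longlongrightarrow> \<beta>) (at_right 0)" and \<beta>: "\<beta> \<ge> 0"
    and R: "(R \<longlongrightarrow> r) (at_right 0)" and T: "(T \<longlongrightarrow> D) (at_right 0)" and D: "D \<noteq> 0"
  shows "((\<lambda>\<sigma>. ereal (- (R \<sigma> * (X \<sigma> ^ 2 * \<sigma>) / 4 + T \<sigma> / 12 * (X \<sigma> ^ 3 * \<sigma>))))
           \<longlongrightarrow> - (\<beta> / 12) * ereal D) (at_right 0)"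
proof (cases \<beta>)
  case (real b)
  then have w': "((\<lambda>\<sigma>. X \<sigma> ^ 3 * \<sigma>) \<longlongrightarrow> b) (at_right 0)" using w by simp
  have "((\<lambda>\<sigma>. (X \<sigma> ^ 3 * \<sigma>)\<^sup>2 * \<sigma>) \<longlongrightarrow> b\<^sup>2 * 0) (at_right 0)"
    by (intro tendsto_intros w')
  then have "((\<lambda>\<sigma>. (X \<sigma> ^ 2 * \<sigma>) ^ 3) \<longlongrightarrow> 0) (at_right 0)"
    by (simp add: power_mult_distrib power2_eq_square power3_eq_cube mult_ac)
  then have u: "((\<lambda>\<sigma>. X \<sigma> ^ 2 * \<sigma>) \<longlongrightarrow> 0) (at_right 0)" by (rule tendsto_0_of_cube)
  have "((\<lambda>\<sigma>. - (R \<sigma> * (X \<sigma> ^ 2 * \<sigma>) / 4 + T \<sigma> / 12 * (X \<sigma> ^ 3 * \<sigma>)))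
          \<longlongrightarrow> - (r * 0 / 4 + D / 12 * b)) (at_right 0)"
    by (intro tendsto_intros R T u w') simp_all
  then show ?thesis using real by (simp add: mult_ac)
next
  case PInf
  then have w': "filterlim (\<lambda>\<sigma>. X \<sigma> ^ 3 * \<sigma>) at_top (at_right 0)"
    using w by (simp add: tendsto_PInfty_eq_at_top)
  have "((\<lambda>\<sigma>. inverse (X \<sigma> ^ 3 * \<sigma>)) \<longlongrightarrow> 0) (at_right 0)"
    using w' by (rule filterlim_compose[OF tendsto_inverse_0_at_top[OF filterlim_ident]])
  then have "((\<lambda>\<sigma>. inverse (X \<sigma> ^ 3 * \<sigma>) * \<sigma>) \<longlongrightarrow> 0 * 0) (at_right 0)"
    by (intro tendsto_intros)
  moreover have pos: "\<forall>\<^sub>F \<sigma> in at_right 0. X \<sigma> ^ 3 * \<sigma> > 0"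
    using w' by (simp add: filterlim_at_top_dense)
  moreover have "\<forall>\<^sub>F \<sigma> in at_right 0. inverse (X \<sigma> ^ 3 * \<sigma>) * \<sigma> = (inverse (X \<sigma>)) ^ 3"
    using pos by eventually_elim (auto simp: field_simps)
  ultimately have "((\<lambda>\<sigma>. (inverse (X \<sigma>)) ^ 3) \<longlongrightarrow> 0) (at_right 0)"
    using Lim_transform_eventually by fastforce
  then have i: "((\<lambda>\<sigma>. inverse (X \<sigma>)) \<longlongrightarrow> 0) (at_right 0)" by (rule tendsto_0_of_cube)
  have "((\<lambda>\<sigma>. - (R \<sigma> * inverse (X \<sigma>) / 4 + T \<sigma> / 12)) \<longlongrightarrow> - (r * 0 / 4 + D / 12)) (at_right 0)"
    by (intro tendsto_intros R T i) simp_all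
  then have "((\<lambda>\<sigma>. ereal (- (R \<sigma> * inverse (X \<sigma>) / 4 + T \<sigma> / 12)) * ereal (X \<sigma> ^ 3 * \<sigma>))
      \<longlongrightarrow> ereal (- D / 12) * \<infinity>) (at_right 0)"
    using w PInf D by (intro tendsto_mult_ereal) auto
  moreover have "ereal (- D / 12) * \<infinity> = - (\<beta> / 12) * ereal D"
    using PInf D by (cases "D > 0") auto
  moreover have "\<forall>\<^sub>F \<sigma> in at_right 0. ereal (- (R \<sigma> * inverse (X \<sigma>) / 4 + T \<sigma> / 12)) * ereal (X \<sigma> ^ 3 * \<sigma>)
      = ereal (- (R \<sigma> * (X \<sigma> ^ 2 * \<sigma>) / 4 + T \<sigma> / 12 * (X \<sigma> ^ 3 * \<sigma>)))"
    using pos by eventually_elim (auto simp: field_simps power2_eq_square power3_eq_cube)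
  ultimately show ?thesis
    using Lim_transform_eventually by fastforce
next
  case MInf
  then show ?thesis using \<beta> by simp
qed

text \<open>
  The cube of the distance \<open>\<sigma> * X\<close> between argument and position is \<open>\<sigma>\<^sup>2\<close> times the convergent \<open>X ^ 3 * \<sigma>\<close>.
\<close>

lemma step_tendsto_0:
  fixes X :: "real \<Rightarrow> real"
  assumes "((\<lambda>\<sigma>. ereal (X \<sigma> ^ 3 * \<sigma>)) \<longlongrightarrow> ereal b) (at_right 0)"
  shows "((\<lambda>\<sigma>. \<sigma> * X \<sigma>) \<longlongrightarrow> 0) (at_right 0)"
proof (rule tendsto_0_of_cube)
  have "((\<lambda>\<sigma>. \<sigma> * \<sigma> * (X \<sigma> ^ 3 * \<sigma>)) \<longlongrightarrow> 0 * 0 * b) (at_right 0)"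
    using assms by (intro tendsto_intros) simp
  then show "((\<lambda>\<sigma>. (\<sigma> * X \<sigma>) ^ 3) \<longlongrightarrow> 0) (at_right 0)"
    by (simp add: power_mult_distrib power3_eq_cube mult_ac)
qed

section \<open>The ratio of the standardized density to the normal density\<close>

theorem theorem2:
  fixes C \<Omega> :: "real set" and a d :: "real \<Rightarrow> real \<Rightarrow> real" and \<mu>0 \<mu> :: real
    and M :: "real \<Rightarrow> 'w measure" and Y :: "real \<Rightarrow> 'w \<Rightarrow> real"
    and x :: "real \<Rightarrow> real" and \<beta> :: ereal
  assumes "is_interval \<Omega>" and "is_interval C" and "open \<Omega>" and "\<Omega> \<subseteq> C"
    and "\<mu>0 \<in> \<Omega>"
    and "\<And>\<sigma>. \<sigma> > 0 \<Longrightarrow> \<mu>0 + \<sigma> * \<mu> \<in> \<Omega> \<Longrightarrow> has_DM C \<Omega> a d (\<mu>0 + \<sigma> * \<mu>) (\<sigma>\<^sup>2) (M \<sigma>) (Y \<sigma>)"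
    and "uniform_saddlepoint C \<Omega> a d"
    and "C_k_on 3 (\<lambda>(y, m). d y m) (\<Omega> \<times> \<Omega>)"
    and "partial_y 3 d \<mu>0 \<mu>0 \<noteq> 0"
    and "\<And>\<sigma>. \<sigma> > 0 \<Longrightarrow> x \<sigma> > 0"
    and "\<beta> \<ge> 0"
    and "((\<lambda>\<sigma>. ereal ((x \<sigma> - \<mu>) ^ 3 * \<sigma>)) \<longlongrightarrow> \<beta>) (at_right 0)"
    and "\<beta> = \<infinity> \<Longrightarrow> ((\<lambda>\<sigma>. \<sigma> * x \<sigma>) \<longlongrightarrow> 0) (at_right 0)"
  shows "((\<lambda>\<sigma>. ereal (DM_std_pdf a d \<mu>0 \<mu> \<sigma> (x \<sigma>)
                        / normal_density \<mu> (sqrt (unit_variance d \<mu>0)) (x \<sigma>)))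
          \<longlongrightarrow> exp_ereal (- (\<beta> / 12) * ereal (partial_y 3 d \<mu>0 \<mu>0))) (at_right 0)"
proof -
  note iv = \<open>is_interval \<Omega>\<close> and op = \<open>open \<Omega>\<close> and sub = \<open>\<Omega> \<subseteq> C\<close> and \<mu>0 = \<open>\<mu>0 \<in> \<Omega>\<close>
    and C3 = \<open>C_k_on 3 (\<lambda>(y, m). d y m) (\<Omega> \<times> \<Omega>)\<close>
  have ud: "unit_deviance C \<Omega> d" and C2: "C_k_on 2 (\<lambda>(y, m). d y m) (\<Omega> \<times> \<Omega>)"
    and pos: "\<And>m. m \<in> \<Omega> \<Longrightarrow> partial_mu 2 d m m > 0"
    using assms(7) by (auto simp: uniform_saddlepoint_def regular_unit_deviance_def)
  have opp: "open (\<Omega> \<times> \<Omega>)" using op op by (rule open_Times)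
  define q where "q = (\<lambda>m. partial_y 2 d m m)"
  have q: "q m = partial_mu 2 d m m" if "m \<in> \<Omega>" for m
    unfolding q_def by (rule second_partials_agree_on_diagonal[OF ud sub op iv C2 that])
  have V: "unit_variance d m = 2 / q m" "q m > 0" if "m \<in> \<Omega>" for m
    using q[OF that] pos[OF that] by (simp_all add: unit_variance_def)
  define X y m where "X = (\<lambda>\<sigma>. x \<sigma> - \<mu>)" and "y = (\<lambda>\<sigma>. \<mu>0 + \<sigma> * x \<sigma>)" and "m = (\<lambda>\<sigma>. \<mu>0 + \<sigma> * \<mu>)"
  have w: "((\<lambda>\<sigma>. ereal (X \<sigma> ^ 3 * \<sigma>)) \<longlongrightarrow> \<beta>) (at_right 0)"
    using assms(12) by (simp add: X_def)
  have \<sigma>\<mu>: "((\<lambda>\<sigma>. \<sigma> * \<mu>) \<longlongrightarrow> 0) (at_right 0)"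
    by (rule tendsto_eq_intros refl | simp)+
  have \<sigma>x: "((\<lambda>\<sigma>. \<sigma> * x \<sigma>) \<longlongrightarrow> 0) (at_right 0)"
  proof (cases \<beta>)
    case (real b)
    then have "((\<lambda>\<sigma>. \<sigma> * X \<sigma>) \<longlongrightarrow> 0) (at_right 0)" using w by (intro step_tendsto_0) simp
    from tendsto_add[OF this \<sigma>\<mu>] show ?thesis by (simp add: X_def algebra_simps)
  qed (use assms(11,13) in auto)
  have y: "(y \<longlongrightarrow> \<mu>0) (at_right 0)" and m: "(m \<longlongrightarrow> \<mu>0) (at_right 0)"
    unfolding y_def m_def using tendsto_add[OF tendsto_const \<sigma>x] tendsto_add[OF tendsto_const \<sigma>\<mu>] by auto
  have y\<Omega>: "\<forall>\<^sub>F \<sigma> in at_right 0. y \<sigma> \<in> \<Omega>" and m\<Omega>: "\<forall>\<^sub>F \<sigma> in at_right 0. m \<sigma> \<in> \<Omega>"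
    using topological_tendstoD[OF y op \<mu>0] topological_tendstoD[OF m op \<mu>0] by auto

  have "\<exists>\<xi>. y \<sigma> \<in> \<Omega> \<longrightarrow> m \<sigma> \<in> \<Omega> \<longrightarrow> \<xi> \<in> closed_segment (m \<sigma>) (y \<sigma>) \<and>
      d (y \<sigma>) (m \<sigma>) = q (m \<sigma>) / 2 * (y \<sigma> - m \<sigma>)\<^sup>2 + partial_y 3 d \<xi> (m \<sigma>) / 6 * (y \<sigma> - m \<sigma>) ^ 3" for \<sigma>
    unfolding q_def using unit_deviance_cubic_expansion[OF ud sub op iv C3] by metis
  then obtain \<xi> where \<xi>: "\<And>\<sigma>. y \<sigma> \<in> \<Omega> \<Longrightarrow> m \<sigma> \<in> \<Omega> \<Longrightarrow> \<xi> \<sigma> \<in> closed_segment (m \<sigma>) (y \<sigma>) \<and>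
      d (y \<sigma>) (m \<sigma>) = q (m \<sigma>) / 2 * (y \<sigma> - m \<sigma>)\<^sup>2 + partial_y 3 d (\<xi> \<sigma>) (m \<sigma>) / 6 * (y \<sigma> - m \<sigma>) ^ 3"
    by metis
  have \<xi>_lim: "(\<xi> \<longlongrightarrow> \<mu>0) (at_right 0)"
    using m y by (rule tendsto_in_closed_segment) (use y\<Omega> m\<Omega> in eventually_elim, use \<xi> in blast)
  have T: "((\<lambda>\<sigma>. partial_y 3 d (\<xi> \<sigma>) (m \<sigma>)) \<longlongrightarrow> partial_y 3 d \<mu>0 \<mu>0) (at_right 0)"
    by (rule tendsto_on_open_pair[OF continuous_on_partial(1)[OF C3 order_refl opp] op op \<mu>0 \<mu>0 \<xi>_lim m])

  have diff: "(q has_real_derivative deriv q \<mu>0) (at \<mu>0)"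
    unfolding q_def using second_partial_differentiable_on_diagonal[OF C3 op \<mu>0]
    by (simp add: DERIV_deriv_iff_real_differentiable)
  have "((\<lambda>\<sigma>. q (\<mu>0 + \<sigma> * \<mu>)) has_real_derivative deriv q \<mu>0 * \<mu>) (at 0)"
    by (rule DERIV_chain'[where g = q]) (use diff in \<open>auto intro!: derivative_eq_intros\<close>)
  then have "((\<lambda>\<sigma>. (q (m \<sigma>) - q \<mu>0) / \<sigma>) \<longlongrightarrow> deriv q \<mu>0 * \<mu>) (at 0)"
    by (simp add: DERIV_def m_def)
  then have R: "((\<lambda>\<sigma>. (q (m \<sigma>) - q \<mu>0) / \<sigma>) \<longlongrightarrow> deriv q \<mu>0 * \<mu>) (at_right 0)"
    by (rule tendsto_within_subset) simp

  (* the exponent left in the ratio; it tends to the exponent in the claim *)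
  define E where "E = (\<lambda>\<sigma>. - ((q (m \<sigma>) - q \<mu>0) / \<sigma> * (X \<sigma> ^ 2 * \<sigma>) / 4
      + partial_y 3 d (\<xi> \<sigma>) (m \<sigma>) / 12 * (X \<sigma> ^ 3 * \<sigma>)))"
  have "((\<lambda>\<sigma>. ereal (E \<sigma>)) \<longlongrightarrow> - (\<beta> / 12) * ereal (partial_y 3 d \<mu>0 \<mu>0)) (at_right 0)"
    unfolding E_def using w assms(11) R T assms(9) by (rule cubic_exponent_tendsto)
  then have lim_exp: "((\<lambda>\<sigma>. ereal (exp (E \<sigma>)))
      \<longlongrightarrow> exp_ereal (- (\<beta> / 12) * ereal (partial_y 3 d \<mu>0 \<mu>0))) (at_right 0)"
    by (rule exp_ereal_tendsto)

  define v where "v = (\<lambda>z. (2 * pi * unit_variance d z) powr (- 1 / 2))"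
  have v0: "v \<mu>0 = 1 / sqrt (2 * pi * unit_variance d \<mu>0)" "v \<mu>0 > 0"
    using V[OF \<mu>0] by (simp_all add: v_def powr_minus powr_half_sqrt inverse_eq_divide)
  (* y \<sigma> moves, hence the uniformity of the approximation on a ball around \<mu>0 *)
  have P: "((\<lambda>\<sigma>. \<sigma> * a (y \<sigma>) (\<sigma>\<^sup>2)) \<longlongrightarrow> v \<mu>0) (at_right 0)"
  proof -
    obtain r where r: "r > 0" "cball \<mu>0 r \<subseteq> \<Omega>" using op \<mu>0 open_contains_cball by blast
    have "uniform_limit (cball \<mu>0 r) (\<lambda>\<sigma> y. \<sigma> * a y (\<sigma>\<^sup>2)) v (at_right 0)"
      unfolding v_def using assms(7) r by (auto simp: uniform_saddlepoint_def)
    moreover have "\<forall>\<^sub>F \<sigma> in at_right 0. y \<sigma> \<in> cball \<mu>0 r"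
      using tendstoD[OF y r(1)] by eventually_elim (simp add: dist_commute)
    moreover have "((\<lambda>\<sigma>. v (y \<sigma>)) \<longlongrightarrow> v \<mu>0) (at_right 0)"
    proof -
      have "((\<lambda>\<sigma>. partial_mu 2 d (y \<sigma>) (y \<sigma>)) \<longlongrightarrow> partial_mu 2 d \<mu>0 \<mu>0) (at_right 0)"
        by (rule tendsto_on_open_pair[OF continuous_on_partial(2)[OF C2 order_refl opp] op op \<mu>0 \<mu>0 y y])
      then show ?thesis
        unfolding v_def unit_variance_def using pos[OF \<mu>0] by (intro tendsto_intros) auto
    qed
    ultimately show ?thesis by (rule uniform_limit_tendsto_compose)
  qed
  have one: "v \<mu>0 / v \<mu>0 = 1" using v0(2) by (intro divide_self) simp
  from P have "((\<lambda>\<sigma>. \<sigma> * a (y \<sigma>) (\<sigma>\<^sup>2) / v \<mu>0) \<longlongrightarrow> v \<mu>0 / v \<mu>0) (at_right 0)"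
    by (intro tendsto_intros) (use v0(2) in auto)
  then have "((\<lambda>\<sigma>. ereal (\<sigma> * a (y \<sigma>) (\<sigma>\<^sup>2) / v \<mu>0)) \<longlongrightarrow> ereal 1) (at_right 0)"
    unfolding one by (rule tendsto_ereal)
  from tendsto_mult_ereal[OF this lim_exp]
  have lim: "((\<lambda>\<sigma>. ereal (\<sigma> * a (y \<sigma>) (\<sigma>\<^sup>2) / v \<mu>0) * ereal (exp (E \<sigma>)))
      \<longlongrightarrow> exp_ereal (- (\<beta> / 12) * ereal (partial_y 3 d \<mu>0 \<mu>0))) (at_right 0)"
    by simp
  have "\<forall>\<^sub>F \<sigma> in at_right 0. ereal (\<sigma> * a (y \<sigma>) (\<sigma>\<^sup>2) / v \<mu>0) * ereal (exp (E \<sigma>)) =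
      ereal (DM_std_pdf a d \<mu>0 \<mu> \<sigma> (x \<sigma>) / normal_density \<mu> (sqrt (unit_variance d \<mu>0)) (x \<sigma>))"
    using y\<Omega> m\<Omega> eventually_at_right_less[of 0]
  proof eventually_elim
    case (elim \<sigma>)
    have ym: "y \<sigma> - m \<sigma> = \<sigma> * X \<sigma>" by (simp add: y_def m_def X_def algebra_simps)
    have e: "E \<sigma> = - (1 / (2 * \<sigma>\<^sup>2)) * d (y \<sigma>) (m \<sigma>) + (X \<sigma>)\<^sup>2 * q \<mu>0 / 4"
      unfolding E_def conjunct2[OF \<xi>[OF elim(1,2)]] ym using elim(3)
      by (simp add: field_simps power2_eq_square power3_eq_cube)
    have n: "normal_density \<mu> (sqrt (unit_variance d \<mu>0)) (x \<sigma>) = v \<mu>0 * exp (- ((X \<sigma>)\<^sup>2 * q \<mu>0 / 4))"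
      unfolding v0(1) normal_density_def X_def V(1)[OF \<mu>0] using V(2)[OF \<mu>0] by (simp add: mult_ac)
    have "exp (E \<sigma>) = exp (- (1 / (2 * \<sigma>\<^sup>2)) * d (y \<sigma>) (m \<sigma>)) / exp (- ((X \<sigma>)\<^sup>2 * q \<mu>0 / 4))"
      unfolding e by (simp only: exp_diff[symmetric] diff_minus_eq_add)
    moreover have "DM_std_pdf a d \<mu>0 \<mu> \<sigma> (x \<sigma>)
        = \<sigma> * a (y \<sigma>) (\<sigma>\<^sup>2) * exp (- (1 / (2 * \<sigma>\<^sup>2)) * d (y \<sigma>) (m \<sigma>))"
      by (simp only: DM_std_pdf_def DM_pdf_def y_def m_def mult.assoc)
    ultimately show ?case
      using n by (simp only: times_ereal.simps times_divide_times_eq)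
  qed
  with lim show ?thesis by (rule Lim_transform_eventually)
qed

end
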